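(* Given posterior draws $\{\vartheta^{(j)},\ j=1,\dots,J\}$, with $\theta$-subvectors $\theta^{(j)}\in\mathbb{R}^p$, the numerical standard error (NSE) of the estimated statistic $\widehat{\mathbf{T}}(\mathbf{y},\theta_0)$ is $$NSE\left(\widehat{\mathbf{T}}(\mathbf{y},\theta_0)\right)=\sqrt{\frac{\partial\widehat{\mathbf{T}}(\mathbf{y},\theta_0)}{\partial\widehat{\mathbf{h}}}\,Var(\widehat{\mathbf{h}})\left(\frac{\partial\widehat{\mathbf{T}}(\mathbf{y},\theta_0)}{\partial\widehat{\mathbf{h}}}\right)'},$$ where $$\frac{\partial\widehat{\mathbf{T}}(\mathbf{y},\theta_0)}{\partial\widehat{\mathbf{h}}}=-\mathrm{vec}(\mathbf{A}')'\left(\widehat{\mathbf{H}}'^{-1}\otimes\widehat{\mathbf{H}}^{-1}\right)\frac{\partial\widehat{\mathbf{H}}}{\partial\widehat{\mathbf{h}}},$$ $$\widehat{\mathbf{H}}=\frac1J\sum_{j=1}^J(\theta^{(j)}-\bar\theta)(\theta^{(j)}-\bar\theta)',\quad \mathbf{A}=(\bar\theta-\theta_0)(\bar\theta-\theta_0)',\quad \widehat{\mathbf{h}}=\mathrm{vech}(\widehat{\mathbf{H}}),\quad \frac{\partial\widehat{\mathbf{H}}}{\partial\widehat{\mathbf{h}}}=\frac{\partial\,\mathrm{vec}(\widehat{\mathbf{H}})}{\partial\widehat{\mathbf{h}}}.$$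
   Context: Setting: $\vartheta=(\theta',\psi')'$ has posterior density $p(\vartheta|\mathbf{y})$ given data $\mathbf{y}$; $\theta\in\mathbb{R}^p$ is the parameter of interest, $\theta_0\in\mathbb{R}^p$ a fixed hypothesized value, and $\bar\theta$ the posterior mean of $\theta$. The test statistic is $$\mathbf{T}(\mathbf{y},\theta_0)=\int(\theta-\theta_0)'[\mathbf{V}_{\theta\theta}(\bar\vartheta)]^{-1}(\theta-\theta_0)\,p(\vartheta|\mathbf{y})\,d\vartheta,$$ where $\mathbf{V}_{\theta\theta}(\bar\vartheta)=\int(\theta-\bar\theta)(\theta-\bar\theta)'p(\vartheta|\mathbf{y})\,d\vartheta$. It equals $p+\mathrm{tr}(\mathbf{A}\,\mathbf{V}_{\theta\theta}(\bar\vartheta)^{-1})$, and its MCMC estimator is $$\widehat{\mathbf{T}}(\mathbf{y},\theta_0)=p+\mathrm{tr}(\mathbf{A}\widehat{\mathbf{H}}^{-1}),$$ with $\widehat{\mathbf{H}}$ (invertible) the draw-based estimate of $\mathbf{V}_{\theta\theta}(\bar\vartheta)$. Conventions: $\mathrm{vec}$ stacks columns; $\mathrm{vech}$ stacks the lower-triangular part of a symmetric matrix into a $p(p+1)/2$-vector; $\partial\,\mathrm{vec}(\widehat{\mathbf{H}})/\partial\widehat{\mathbf{h}}$ is the $p^2\times p(p+1)/2$ Jacobian of $\mathrm{vec}$ of a symmetric matrix with respect to its $\mathrm{vech}$; $\partial\widehat{\mathbf{T}}/\partial\widehat{\mathbf{h}}$ is the $1\times p(p+1)/2$ row vector of partial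 derivatives of $\widehat{\mathbf{T}}$ as a function of $\widehat{\mathbf{h}}$, with $\mathbf{A}$ held fixed. $Var(\widehat{\mathbf{h}})$ denotes the (numerical) covariance matrix of $\widehat{\mathbf{h}}$ measuring its simulation error. The NSE of $\widehat{\mathbf{T}}$ is the standard error of $\widehat{\mathbf{T}}$ as a function of $\widehat{\mathbf{h}}$ in the sense of the Delta method (the square root of the variance of the first-order linearization of $\widehat{\mathbf{T}}$ in $\widehat{\mathbf{h}}$, when $\widehat{\mathbf{h}}$ has covariance $Var(\widehat{\mathbf{h}})$). *)

theory Defs
  imports "HOL-Probability.Probability"
begin

text \<open>
  Matrices are indexed by a finite type \<open>'p\<close>, so entries of stacked vectors are labelled
  by pairs (column, row) instead of by running numbers: \<open>vec_cols\<close> uses all pairs and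
  \<open>vech\<close> the pairs with column \<open>\<le>\<close> row. Listing these labels lexicographically gives the
  usual column-by-column order. The linear order on \<open>'p\<close> serves only to say which entries
  are on or below the diagonal.
\<close>

typedef (overloaded) ('p::"{finite,linorder}") lower =
  "{k :: 'p \<times> 'p. fst k \<le> snd k}"
  by auto

instance lower :: ("{finite,linorder}") finite
proof
  have "inj Rep_lower"
    by (meson Rep_lower_inject injI)
  then show "finite (UNIV :: 'a lower set)"
    by (rule finite_imageD[rotated]) simp
qed

lemma card_lower: "CARD('p::{finite,linorder} lower) = CARD('p) * (CARD('p) + 1) div 2"
proof -
  let ?L = "{k :: 'p \<times> 'p. fst k \<le> snd k}" and ?U = "{k :: 'p \<times> 'p. snd k \<le> fst k}"
  have L: "CARD('p lower) = card ?L"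
    by (rule type_definition.card[OF type_definition_lower])
  have "card (prod.swap ` ?L) = card ?L"
    by (rule card_image) (auto intro: inj_onI)
  moreover have "prod.swap ` ?L = ?U"
    by (auto simp: image_iff)
  ultimately have "card ?L + card ?L = card ?L + card ?U"
    by simp
  also have "\<dots> = card (?L \<union> ?U) + card (?L \<inter> ?U)"
    by (rule card_Un_Int) auto
  also have "?L \<union> ?U = UNIV"
    by auto
  also have "?L \<inter> ?U = (\<lambda>i. (i, i)) ` UNIV"
    by (auto simp: image_iff)
  also have "card \<dots> = CARD('p)"
    by (rule card_image) (auto intro: inj_onI)
  finally have "2 * CARD('p lower) = CARD('p) * (CARD('p) + 1)"
    using L by (simp add: algebra_simps)
  then show ?thesis
    by linarith
qed

definition vec_cols :: "'a^'n^'m \<Rightarrow> 'a^('n \<times> 'm)" where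
  "vec_cols A = (\<chi> k. A $ snd k $ fst k)"

definition vech :: "'a^'p::{finite,linorder}^'p::{finite,linorder} \<Rightarrow> 'a^'p::{finite,linorder} lower" where
  "vech A = (\<chi> k. A $ snd (Rep_lower k) $ fst (Rep_lower k))"

text \<open>The symmetric matrix with a given \<open>vech\<close>; it expresses a function of a symmetric
  matrix as a function of its free entries.\<close>

definition unvech :: "'a^'p::{finite,linorder} lower \<Rightarrow> 'a^'p::{finite,linorder}^'p::{finite,linorder}" where
  "unvech h = (\<chi> i j. h $ Abs_lower (min i j, max i j))"

lemma vech_unvech: "vech (unvech h) = h"
proof -
  have "Abs_lower (min (snd (Rep_lower k)) (fst (Rep_lower k)),
          max (snd (Rep_lower k)) (fst (Rep_lower k))) = k" for k :: "'b lower"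
    using Rep_lower[of k] by (simp add: min_absorb2 max_absorb1 Rep_lower_inverse)
  then show ?thesis
    by (simp add: vech_def unvech_def vec_eq_iff)
qed

lemma unvech_vech:
  assumes "transpose A = A"
  shows "unvech (vech A) = A"
proof -
  have sym: "A $ i $ j = A $ j $ i" for i j
    using assms by (metis transpose_def vec_lambda_beta)
  have "A $ max i j $ min i j = A $ i $ j" for i j
    using sym by (cases "i \<le> j") (auto simp: max_def min_def)
  moreover have "Rep_lower (Abs_lower (min i j, max i j)) = (min i j, max i j)" for i j :: 'b
    by (rule Abs_lower_inverse) (simp add: min.coboundedI1)
  ultimately show ?thesis
    by (simp add: vech_def unvech_def vec_eq_iff)
qed

lemma linear_vec_cols_unvech:
  "linear (\<lambda>h :: real^'p::{finite,linorder} lower. vec_cols (unvech h))"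
  by (rule linearI) (simp_all add: vec_cols_def unvech_def vec_eq_iff)

definition kronecker :: "'a::times^'n^'m \<Rightarrow> 'a^'l^'k \<Rightarrow> 'a^('n \<times> 'l)^('m \<times> 'k)" where
  "kronecker A B = (\<chi> r c. A $ fst r $ fst c * B $ snd r $ snd c)"

definition outer :: "real^'n \<Rightarrow> real^'m \<Rightarrow> real^'m^'n" where
  "outer u v = (\<chi> i j. u $ i * v $ j)"

text \<open>Row vectors are elements of \<open>real^'n\<close> multiplying matrices from the left by
  \<open>(v*)\<close>.\<close>

definition partials :: "(real^'n \<Rightarrow> real) \<Rightarrow> real^'n \<Rightarrow> real^'n" where
  "partials f x = (\<chi> k. deriv (\<lambda>t. f (x + t *\<^sub>R axis k 1)) 0)"

definition linearization ::
  "('a::real_normed_vector \<Rightarrow> 'b::real_normed_vector) \<Rightarrow> 'a \<Rightarrow> 'a \<Rightarrow> 'b" where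
  "linearization f a x = f a + frechet_derivative f (at a) (x - a)"

definition cov_matrix :: "'w measure \<Rightarrow> ('w \<Rightarrow> real^'n) \<Rightarrow> real^'n^'n" where
  "cov_matrix M X = (\<chi> k l. LINT w|M. (X w $ k - (LINT v|M. X v $ k)) *
                                     (X w $ l - (LINT v|M. X v $ l)))"

text \<open>Standard error of \<open>f X\<close> by the Delta method, linearizing at the point \<open>a\<close>.\<close>

definition delta_se :: "'w measure \<Rightarrow> ('w \<Rightarrow> real^'n) \<Rightarrow> (real^'n \<Rightarrow> real) \<Rightarrow> real^'n \<Rightarrow> real" where
  "delta_se M X f a = sqrt (prob_space.variance M (\<lambda>w. linearization f a (X w)))"

definition prob_density :: "('a::euclidean_space \<Rightarrow> real) \<Rightarrow> bool" where
  "prob_density f \<longleftrightarrow> (\<forall>x. 0 \<le> f x) \<and> has_bochner_integral lborel f 1"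

text \<open>A parameter is a pair \<open>(\<theta>, \<psi>)\<close> with \<open>\<theta>\<close> the component of interest.\<close>

definition post_mean :: "((real^'p) \<times> (real^'m) \<Rightarrow> real) \<Rightarrow> real^'p" where
  "post_mean post = (LINT x|lborel. post x *\<^sub>R fst x)"

definition H_hat :: "real^'p \<Rightarrow> nat \<Rightarrow> (nat \<Rightarrow> (real^'p) \<times> (real^'m)) \<Rightarrow> real^'p^'p" where
  "H_hat m J x = (1 / real J) *\<^sub>R (\<Sum>j=1..J. outer (fst (x j) - m) (fst (x j) - m))"

lemma transpose_H_hat: "transpose (H_hat m J x) = H_hat m J x"
  by (simp add: H_hat_def outer_def transpose_def vec_eq_iff mult.commute)

definition T_hat :: "real^'p^'p \<Rightarrow> real^'p^'p \<Rightarrow> real" where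
  "T_hat A H = real CARD('p) + trace (A ** matrix_inv H)"

end

theory Submission
  imports Defs
begin

text \<open>
  Let \<open>K\<close> be the inverse of \<open>H\<close>. Cramer's rule makes matrix inversion continuous, and the
  identity \<open>X\<^sup>-\<^sup>1 - K = - X\<^sup>-\<^sup>1 (X - H) K\<close> turns continuity into the derivative
  \<open>Y \<mapsto> - K Y K\<close>. The \<open>vec\<close>-Kronecker identity and \<open>tr(A B) = vec(A')' vec(B)\<close> convert the
  resulting derivative \<open>Y \<mapsto> - tr(A K Y K)\<close> of the statistic into the row vector of the
  theorem, and the variance of a linear form \<open>g \<bullet> X\<close> is the quadratic form of \<open>g\<close> in the
  covariance matrix.
\<close>

section \<open>Continuity and derivative of matrix inversion\<close>

lemma bounded_bilinear_matrix_matrix_mult: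
  "bounded_bilinear ((**) :: real^'n^'m \<Rightarrow> real^'k^'n \<Rightarrow> real^'k^'m)"
  unfolding bilinear_conv_bounded_bilinear[symmetric] bilinear_def
  by (intro conjI allI linearI)
    (simp_all add: vec_eq_iff matrix_matrix_mult_def sum.distrib sum_distrib_left algebra_simps)

lemma matrix_inv_inverse:
  fixes A :: "real^'n^'n"
  assumes "invertible A"
  shows "A ** matrix_inv A = mat 1" "matrix_inv A ** A = mat 1"
  using someI_ex[OF assms[unfolded invertible_def]] by (simp_all add: matrix_inv_def)

text \<open>A one-sided inverse of a square matrix already makes it invertible; cancelling
  \<open>A\<close> on the left of \<open>A ** B\<close> then isolates \<open>B\<close>.\<close>

lemma matrix_inv_unique:
  fixes A :: "real^'n^'n"
  assumes "A ** B = mat 1"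
  shows "matrix_inv A = B"
proof -
  have "invertible A"
    using assms invertible_right_inverse by blast
  then have "matrix_inv A ** (A ** B) = B"
    by (simp add: matrix_mul_assoc matrix_inv_inverse)
  then show ?thesis
    by (simp add: assms)
qed

lemma matrix_inv_transpose:
  fixes A :: "real^'n^'n"
  assumes "invertible A"
  shows "matrix_inv (transpose A) = transpose (matrix_inv A)"
  by (rule matrix_inv_unique)
    (simp add: matrix_transpose_mul[symmetric] matrix_inv_inverse[OF assms] transpose_mat)

text \<open>Column \<open>l\<close> of the inverse solves \<open>A *v x = axis l 1\<close>, so
  Cramer's rule gives its entry \<open>k\<close> as a quotient of two polynomials in the entries of
  \<open>A\<close>.\<close>

lemma matrix_inv_cramer:
  fixes A :: "real^'n^'n"
  assumes "invertible A"
  shows "matrix_inv A $ k $ l =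
    det (\<chi> i j. if j = k then axis l 1 $ i else A $ i $ j) / det A"
proof -
  have "A *v (matrix_inv A *v axis l 1) = axis l 1"
    by (simp add: matrix_vector_mul_assoc matrix_inv_inverse[OF assms])
  then have "matrix_inv A *v axis l 1 =
      (\<chi> k. det (\<chi> i j. if j = k then axis l 1 $ i else A $ i $ j) / det A)"
    using cramer assms invertible_det_nz by blast
  moreover have "(matrix_inv A *v axis l 1) $ k = matrix_inv A $ k $ l"
    by (simp add: matrix_vector_mul_component inner_axis)
  ultimately show ?thesis
    by simp
qed

lemma tendsto_det:
  fixes f :: "'a \<Rightarrow> real^'n^'n"
  assumes "\<And>i j. ((\<lambda>x. f x $ i $ j) \<longlongrightarrow> L $ i $ j) F"
  shows "((\<lambda>x. det (f x)) \<longlongrightarrow> det L) F"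
  unfolding det_def by (intro tendsto_intros assms)

lemma eventually_invertible:
  fixes A :: "real^'n^'n"
  assumes "invertible A"
  shows "\<forall>\<^sub>F X in at A. invertible X"
proof -
  have "((\<lambda>X. det X) \<longlongrightarrow> det A) (at A)"
    by (intro tendsto_det tendsto_intros)
  then have "\<forall>\<^sub>F X in at A. det X \<noteq> 0"
    by (rule tendsto_imp_eventually_ne) (use assms invertible_det_nz in blast)
  then show ?thesis
    by (simp add: invertible_det_nz)
qed

lemma tendsto_matrix_inv:
  fixes A :: "real^'n^'n"
  assumes A: "invertible A"
  shows "(matrix_inv \<longlongrightarrow> matrix_inv A) (at A)"
proof (intro vec_tendstoI)
  fix k l
  let ?C = "\<lambda>X :: real^'n^'n. \<chi> i j. if j = k then axis l 1 $ i else X $ i $ j"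
  \<comment> \<open>The replaced column \<open>k\<close> does not depend on \<open>X\<close>; every
    other entry is an entry of \<open>X\<close> itself.\<close>
  have entries: "((\<lambda>X. ?C X $ i $ j) \<longlongrightarrow> ?C A $ i $ j) (at A)" for i j
    by (cases "j = k") (auto intro!: tendsto_intros)
  have "((\<lambda>X. det (?C X) / det X) \<longlongrightarrow> det (?C A) / det A) (at A)"
    using A by (intro tendsto_divide tendsto_det entries tendsto_intros)
      (simp add: invertible_det_nz[symmetric])
  \<comment> \<open>The quotient represents the inverse only at invertible \<open>X\<close>, hence
    the eventual equality.\<close>
  moreover have "\<forall>\<^sub>F X in at A. det (?C X) / det X = matrix_inv X $ k $ l"
    using eventually_invertible[OF A] by eventually_elim (simp add: matrix_inv_cramer)
  ultimately show "((\<lambda>X. matrix_inv X $ k $ l) \<longlongrightarrow> matrix_inv A $ k $ l) (at A)"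
    by (subst matrix_inv_cramer[OF A]) (rule Lim_transform_eventually)
qed

text \<open>The first-order remainder factors as
  \<open>- (matrix_inv X - ?K) ** (X - A) ** ?K\<close>. Divided by \<open>norm (X - A)\<close>, it
  is a null factor times a bounded one.\<close>

lemma has_derivative_matrix_inv:
  fixes A :: "real^'n^'n"
  assumes A: "invertible A"
  shows "(matrix_inv has_derivative (\<lambda>Y. - (matrix_inv A ** Y ** matrix_inv A))) (at A)"
proof -
  interpret mm: bounded_bilinear "(**) :: real^'n^'n \<Rightarrow> real^'n^'n \<Rightarrow> real^'n^'n"
    by (rule bounded_bilinear_matrix_matrix_mult)
  let ?K = "matrix_inv A"
  let ?u = "\<lambda>X. (1 / norm (X - A)) *\<^sub>R (X - A)"
  have "bounded_linear (\<lambda>Y. - (?K ** Y ** ?K))"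
    by (intro bounded_linear_minus mm.bounded_linear_left[THEN bounded_linear_compose]
        mm.bounded_linear_right)
  moreover have "((\<lambda>X. (1 / norm (X - A)) *\<^sub>R
      (matrix_inv X - (?K + - (?K ** (X - A) ** ?K)))) \<longlongrightarrow> 0) (at A)"
  proof -
    have "Zfun (\<lambda>X. matrix_inv X - ?K) (at A)"
      using tendsto_matrix_inv[OF A] by (simp add: tendsto_Zfun_iff)
    \<comment> \<open>Away from \<open>A\<close>, \<open>?u X\<close> has norm exactly 1.\<close>
    moreover have "Bfun ?u (at A)"
      by (rule BfunI[of _ 1]) (simp add: eventually_at_filter)
    ultimately have "Zfun (\<lambda>X. (matrix_inv X - ?K) ** ?u X) (at A)"
      by (rule mm.Zfun_prod_Bfun)
    then have "Zfun (\<lambda>X. - ((matrix_inv X - ?K) ** ?u X ** ?K)) (at A)"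
      by (intro Zfun_minus mm.Zfun_left)
    then have "((\<lambda>X. - ((matrix_inv X - ?K) ** ?u X ** ?K)) \<longlongrightarrow> 0) (at A)"
      by (simp add: tendsto_Zfun_iff)
    moreover have "\<forall>\<^sub>F X in at A. - ((matrix_inv X - ?K) ** ?u X ** ?K) =
        (1 / norm (X - A)) *\<^sub>R (matrix_inv X - (?K + - (?K ** (X - A) ** ?K)))"
      using eventually_invertible[OF A]
    proof eventually_elim
      case (elim X)
      have "matrix_inv X ** (X - A) ** ?K = ?K - matrix_inv X"
        by (simp add: mm.diff_left mm.diff_right matrix_inv_inverse elim A
            matrix_mul_assoc[symmetric, of "matrix_inv X" A])
      then have "- ((matrix_inv X - ?K) ** (X - A) ** ?K) =
          matrix_inv X - (?K + - (?K ** (X - A) ** ?K))"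
        by (simp add: mm.diff_left)
      then show ?case
        by (simp only: mm.scaleR_left mm.scaleR_right scaleR_minus_right[symmetric])
    qed
    ultimately show ?thesis
      by (rule Lim_transform_eventually)
  qed
  ultimately show ?thesis
    by (simp add: has_derivative_at2)
qed

section \<open>Vectorization, Kronecker products and traces\<close>

text \<open>Labels are pairs (column, row), so the first Kronecker factor acts on columns, as right
  multiplication by \<open>C\<close> does up to transposition, and the second acts on rows.\<close>

lemma kronecker_mult_vec_cols:
  fixes B :: "'a::comm_semiring_1^'n^'m" and C :: "'a^'l^'k"
  shows "kronecker (transpose C) B *v vec_cols X = vec_cols (B ** X ** C)"
proof -
  have "(kronecker (transpose C) B *v vec_cols X) $ r = vec_cols (B ** X ** C) $ r" for r
  proof -
    have "(kronecker (transpose C) B *v vec_cols X) $ r =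
        (\<Sum>c\<in>UNIV \<times> UNIV. C $ fst c $ fst r * B $ snd r $ snd c * X $ snd c $ fst c)"
      by (simp add: matrix_vector_mult_def kronecker_def vec_cols_def transpose_def)
    also have "\<dots> = (\<Sum>k\<in>UNIV. \<Sum>n\<in>UNIV. C $ k $ fst r * B $ snd r $ n * X $ n $ k)"
      by (subst sum.cartesian_product) (simp add: case_prod_unfold)
    also have "\<dots> = vec_cols (B ** X ** C) $ r"
      by (simp add: vec_cols_def matrix_matrix_mult_def sum_distrib_left sum_distrib_right ac_simps)
    finally show ?thesis .
  qed
  then show ?thesis
    by (simp add: vec_eq_iff)
qed

lemma inner_vec_cols:
  fixes A :: "real^'n^'m"
  shows "vec_cols (transpose A) \<bullet> vec_cols B = trace (A ** B)"
proof -
  have "vec_cols (transpose A) \<bullet> vec_cols B =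
      (\<Sum>k\<in>UNIV \<times> UNIV. A $ fst k $ snd k * B $ snd k $ fst k)"
    by (simp add: inner_vec_def vec_cols_def transpose_def)
  also have "\<dots> = (\<Sum>i\<in>UNIV. \<Sum>j\<in>UNIV. A $ i $ j * B $ j $ i)"
    by (subst sum.cartesian_product) (simp add: case_prod_unfold)
  also have "\<dots> = trace (A ** B)"
    by (simp add: trace_def matrix_matrix_mult_def)
  finally show ?thesis .
qed

section \<open>Gradients and the Delta-method variance\<close>

lemma partials_eq:
  assumes "(f has_derivative (\<lambda>k. g \<bullet> k)) (at x)"
  shows "partials f x = g"
proof -
  have "((\<lambda>t. f (x + t *\<^sub>R axis k 1)) has_field_derivative g $ k) (at 0)" for k
  proof -
    have line: "((\<lambda>t. x + t *\<^sub>R axis k 1) has_derivative (\<lambda>t. t *\<^sub>R axis k 1)) (at 0)"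
      by (auto intro!: derivative_eq_intros)
    have "((\<lambda>t. f (x + t *\<^sub>R axis k 1)) has_derivative (\<lambda>t. g \<bullet> (t *\<^sub>R axis k 1))) (at 0)"
      by (rule has_derivative_compose[OF line, where g = f]) (simp add: assms)
    then show ?thesis
      by (simp add: has_field_derivative_def inner_axis mult.commute[of _ "g $ k"])
  qed
  then show ?thesis
    by (simp add: partials_def vec_eq_iff DERIV_imp_deriv)
qed

text \<open>Centring removes \<open>c\<close>; the square of the remaining sum expands into products
  of centred coordinates, whose expectations are the covariances. Finite second moments make these
  products integrable.\<close>

lemma (in prob_space) variance_linear_form:
  fixes X :: "'a \<Rightarrow> real^'n"
  assumes meas: "\<And>k. (\<lambda>w. X w $ k) \<in> borel_measurable M"
    and sq: "\<And>k. integrable M (\<lambda>w. (X w $ k)\<^sup>2)"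
  shows "variance (\<lambda>w. c + g \<bullet> X w) = (g v* cov_matrix M X) \<bullet> g"
proof -
  have int: "integrable M (\<lambda>w. X w $ k)" for k
    using meas sq by (rule square_integrable_imp_integrable)
  let ?Y = "\<lambda>k w. X w $ k - expectation (\<lambda>w. X w $ k)"
  have Y_sq: "integrable M (\<lambda>w. (?Y k w)\<^sup>2)" for k
    by (simp add: power2_diff int sq)
  have prod_int: "integrable M (\<lambda>w. ?Y k w * ?Y l w)" for k l
  proof (rule Bochner_Integration.integrable_bound)
    show "integrable M (\<lambda>w. (?Y k w)\<^sup>2 + (?Y l w)\<^sup>2)"
      by (intro Bochner_Integration.integrable_add Y_sq)
    show "(\<lambda>w. ?Y k w * ?Y l w) \<in> borel_measurable M"
      by (intro borel_measurable_times borel_measurable_diff meas borel_measurable_const)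
    \<comment> \<open>From 2|a||b| \<le> a^2 + b^2 and |a||b| \<ge> 0.\<close>
    have "\<bar>a * b\<bar> \<le> a\<^sup>2 + b\<^sup>2" for a b :: real
      using sum_squares_bound[of "\<bar>a\<bar>" "\<bar>b\<bar>"] mult_nonneg_nonneg[of "\<bar>a\<bar>" "\<bar>b\<bar>"]
      unfolding abs_mult power2_abs by linarith
    then show "AE w in M. norm (?Y k w * ?Y l w) \<le> norm ((?Y k w)\<^sup>2 + (?Y l w)\<^sup>2)"
      by simp
  qed
  have mean: "expectation (\<lambda>w. c + g \<bullet> X w) = c + (\<Sum>k\<in>UNIV. g $ k * expectation (\<lambda>w. X w $ k))"
    by (simp add: inner_vec_def int prob_space)
  have centred: "c + g \<bullet> X w - expectation (\<lambda>w. c + g \<bullet> X w) = (\<Sum>k\<in>UNIV. g $ k * ?Y k w)" for w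
    by (subst mean) (simp add: inner_vec_def right_diff_distrib sum_subtractf)
  have "variance (\<lambda>w. c + g \<bullet> X w) =
      expectation (\<lambda>w. \<Sum>k\<in>UNIV. \<Sum>l\<in>UNIV. g $ k * g $ l * (?Y k w * ?Y l w))"
    unfolding centred power2_eq_square sum_product by (simp add: ac_simps)
  also have "\<dots> = (\<Sum>k\<in>UNIV. \<Sum>l\<in>UNIV. g $ k * g $ l * cov_matrix M X $ k $ l)"
    by (simp add: prod_int cov_matrix_def)
  \<comment> \<open>Entry \<open>l\<close> of \<open>g v* cov_matrix M X\<close> sums over the row
    index \<open>k\<close>, which must therefore be the inner index.\<close>
  also have "\<dots> = (\<Sum>l\<in>UNIV. \<Sum>k\<in>UNIV. g $ k * g $ l * cov_matrix M X $ k $ l)"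
    by (rule sum.swap)
  also have "\<dots> = (g v* cov_matrix M X) \<bullet> g"
    by (simp add: inner_vec_def vector_matrix_mult_def sum_distrib_left sum_distrib_right ac_simps)
  finally show ?thesis .
qed

lemma (in prob_space) delta_se_eq:
  fixes X :: "'a \<Rightarrow> real^'n"
  assumes der: "(f has_derivative (\<lambda>k. g \<bullet> k)) (at a)"
    and "\<And>k. (\<lambda>w. X w $ k) \<in> borel_measurable M"
    and "\<And>k. integrable M (\<lambda>w. (X w $ k)\<^sup>2)"
  shows "delta_se M X f a = sqrt ((g v* cov_matrix M X) \<bullet> g)"
proof -
  \<comment> \<open>The linearization is affine in \<open>x\<close>; its constant term becomes the
    \<open>c\<close> of \<open>variance_linear_form\<close>.\<close>
  have "linearization f a x = (f a - g \<bullet> a) + g \<bullet> x" for x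
    by (simp add: linearization_def frechet_derivative_at[OF der, symmetric] inner_diff_right)
  then show ?thesis
    using variance_linear_form[OF assms(2,3)] by (simp add: delta_se_def)
qed

section \<open>Derivative of the statistic in the free entries\<close>

lemma has_derivative_T_hat:
  fixes A H :: "real^'p^'p"
  assumes H: "invertible H"
  shows "(T_hat A has_derivative
    (\<lambda>Y. - trace (A ** (matrix_inv H ** Y ** matrix_inv H)))) (at H)"
proof -
  have "bounded_linear (\<lambda>X. trace (A ** X))"
    unfolding linear_conv_bounded_linear[symmetric]
    by (rule linearI) (simp_all add: trace_def matrix_matrix_mult_def sum.distrib
        sum_distrib_left algebra_simps)
  then have "((\<lambda>X. trace (A ** matrix_inv X)) has_derivative
      (\<lambda>Y. trace (A ** - (matrix_inv H ** Y ** matrix_inv H)))) (at H)"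
    using has_derivative_matrix_inv[OF H] by (rule bounded_linear.has_derivative)
  moreover have "trace (A ** - B) = - trace (A ** B)" for B
    by (simp add: trace_def matrix_matrix_mult_def sum_negf)
  ultimately show ?thesis
    unfolding T_hat_def by (auto intro!: derivative_eq_intros)
qed

text \<open>A linear map is its own derivative at every point, and derivatives are unique.\<close>

lemma jacobian_linear:
  fixes f :: "real^'n \<Rightarrow> real^'m"
  assumes "linear f"
  shows "jacobian f (at x) *v k = f k"
proof -
  have "(f has_derivative (\<lambda>k. jacobian f (at x) *v k)) (at x)"
    using linear_imp_differentiable[OF assms] jacobian_works by blast
  then show ?thesis
    using linear_imp_has_derivative[OF assms] has_derivative_unique by metis
qed

lemma has_derivative_T_hat_unvech:
  fixes A H :: "real^'p::{finite,linorder}^'p::{finite,linorder}"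
  assumes H: "invertible H" and sym: "transpose H = H"
  shows "((\<lambda>x. T_hat A (unvech x)) has_derivative
    (\<lambda>k. - ((vec_cols (transpose A) v*
        kronecker (matrix_inv (transpose H)) (matrix_inv H)) v*
        jacobian (\<lambda>x. vec_cols (unvech x)) (at (vech H))) \<bullet> k)) (at (vech H))"
proof -
  let ?K = "matrix_inv H"
  have "linear (unvech :: real^'p::{finite,linorder} lower \<Rightarrow> real^'p::{finite,linorder}^'p::{finite,linorder})"
    by (rule linearI) (simp_all add: unvech_def vec_eq_iff)
  then have "(unvech has_derivative unvech) (at (vech H))"
    by (rule linear_imp_has_derivative)
  then have "((\<lambda>x. T_hat A (unvech x)) has_derivative
      (\<lambda>k. - trace (A ** (?K ** unvech k ** ?K)))) (at (vech H))"
    \<comment> \<open>Symmetry of \<open>H\<close> gives \<open>unvech (vech H) = H\<close>, the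
      point where the outer derivative is known.\<close>
    by (rule has_derivative_compose) (simp add: unvech_vech[OF sym] has_derivative_T_hat[OF H])
  \<comment> \<open>Moving the row-vector products across the inner product, the Jacobian yields
    \<open>vec_cols (unvech k)\<close>, the Kronecker matrix turns this into
    \<open>vec_cols (?K ** unvech k ** ?K)\<close>, and pairing with
    \<open>vec_cols (transpose A)\<close> gives the trace.\<close>
  moreover have "trace (A ** (?K ** unvech k ** ?K)) =
      ((vec_cols (transpose A) v* kronecker (matrix_inv (transpose H)) ?K) v*
        jacobian (\<lambda>x. vec_cols (unvech x)) (at (vech H))) \<bullet> k" for k
    by (simp only: dot_lmul_matrix jacobian_linear[OF linear_vec_cols_unvech]
        matrix_inv_transpose[OF H] kronecker_mult_vec_cols inner_vec_cols)
  ultimately show ?thesis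
    by simp
qed

section \<open>Measurability of the estimate and the standard error\<close>

text \<open>Each entry is a polynomial in the coordinates of the draws \<open>1..J\<close>, since
  the centre \<open>m\<close> is fixed.\<close>

lemma borel_measurable_vech_H_hat:
  fixes x :: "nat \<Rightarrow> 'w \<Rightarrow> (real^'p::{finite,linorder}) \<times> (real^'m)"
  assumes "\<And>j. j \<in> {1..J} \<Longrightarrow> x j \<in> borel_measurable M"
  shows "(\<lambda>v. vech (H_hat m J (\<lambda>j. x j v)) $ k) \<in> borel_measurable M"
proof -
  have "(\<lambda>v. fst (x j v) $ i) \<in> borel_measurable M" if "j \<in> {1..J}" for i j
    by (rule borel_measurable_continuous_on[OF _ assms[OF that]]) (intro continuous_intros)
  then have "(\<lambda>v. 1 / real J * (\<Sum>j=1..J. (fst (x j v) $ a - m $ a) * (fst (x j v) $ b - m $ b)))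
      \<in> borel_measurable M" for a b
    by (intro borel_measurable_times borel_measurable_sum borel_measurable_diff borel_measurable_const)
  then show ?thesis
    by (simp add: vech_def H_hat_def outer_def)
qed

theorem corollary3p2:
  fixes post :: "(real^'p::{finite,linorder}) \<times> (real^'m) \<Rightarrow> real"
    and \<theta>\<^sub>0 :: "real^'p::{finite,linorder}"
    and M :: "'w measure"
    and draw :: "nat \<Rightarrow> 'w \<Rightarrow> (real^'p::{finite,linorder}) \<times> (real^'m)"
    and J :: nat
    and w :: 'w
    and A H h T
  defines "A \<equiv> outer (post_mean post - \<theta>\<^sub>0) (post_mean post - \<theta>\<^sub>0)"
    and "H \<equiv> (\<lambda>v. H_hat (post_mean post) J (\<lambda>j. draw j v))"
    and "h \<equiv> (\<lambda>v. vech (H v))"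
    and "T \<equiv> (\<lambda>x. T_hat A (unvech x))"
  assumes "prob_density post"
    and "integrable lborel (\<lambda>x. post x *\<^sub>R fst x)"
    and "prob_space M"
    and "J \<ge> 1"
    and "\<And>j. j \<in> {1..J} \<Longrightarrow> draw j \<in> borel_measurable M"
    and "\<And>k. integrable M (\<lambda>v. (h v $ k)\<^sup>2)"
    and "w \<in> space M"
    and "invertible (H w)"
  shows "T differentiable (at (h w)) \<and>
         delta_se M h T (h w) =
           sqrt ((partials T (h w) v* cov_matrix M h) \<bullet> partials T (h w)) \<and>
         partials T (h w) =
           - ((vec_cols (transpose A) v*
                kronecker (matrix_inv (transpose (H w))) (matrix_inv (H w))) v*
                jacobian (\<lambda>x. vec_cols (unvech x)) (at (h w)))"
proof -
  interpret prob_space M by fact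
  \<comment> \<open>Once \<open>?g\<close> is shown to represent the total derivative,
    differentiability, the partial derivatives and the standard error all follow from it.\<close>
  let ?g = "- ((vec_cols (transpose A) v*
                kronecker (matrix_inv (transpose (H w))) (matrix_inv (H w))) v*
                jacobian (\<lambda>x. vec_cols (unvech x)) (at (h w)))"
  have der: "(T has_derivative (\<lambda>k. ?g \<bullet> k)) (at (h w))"
    using has_derivative_T_hat_unvech[of "H w" A] \<open>invertible (H w)\<close>
    by (simp add: T_def h_def H_def transpose_H_hat)
  have "(\<lambda>v. h v $ k) \<in> borel_measurable M" for k
    unfolding h_def H_def by (rule borel_measurable_vech_H_hat) fact
  then have "delta_se M h T (h w) = sqrt ((?g v* cov_matrix M h) \<bullet> ?g)"
    using assms(10) by (intro delta_se_eq[OF der])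
  then show ?thesis
    using der by (simp add: partials_eq[OF der] differentiableI)
qed

end
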